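(* Let $k\ge 2$, let $\mathbf n=(n_1,\dots,n_k)$ be integers with $1\le n_1\le\cdots\le n_k$, and let $\mathbf g=(g_1,g_2,\dots)$ be integers with $1=g_1<g_2<\cdots$, $g_r\mid g_{r+1}$ for all $r$, and such that $\gamma_r=g_{r+1}/g_r$ satisfies $\sum_{r=1}^\infty \gamma_r^{-k}<\infty$. Then those chains $(\phi_1,\phi_2,\dots)$ in the ensemble $\mathcal E(\mathbf n,\mathbf g)$ such that all but finitely many of the homomorphisms $\phi_r$ are injective form a set of full measure in $\mathcal E(\mathbf n,\mathbf g)$. That is, with probability $1$, a randomly selected chain in $\mathcal E(\mathbf n,\mathbf g)$ has all but finitely many homomorphisms injective.
   Context: $\mathcal M_m$ denotes the C*-algebra of $m\times m$ complex matrices. For $r\ge1$ put $\mathcal A_r=\bigoplus_{i=1}^k \mathcal M_{g_rn_i}$. A unital *-homomorphism $\phi:\bigoplus_{i=1}^k\mathcal M_{p_i}\to\bigoplus_{j=1}^{\ell}\mathcal M_{q_j}$ is standard if $\phi(a_1,\dots,a_k)=(b_1,\dots,b_\ell)$ where each $b_j$ is block diagonal with diagonal blocks among $a_1,\dots,a_k$ listed in increasing order of subscript. It is uniquely determined by its matrix of partial multiplicities $X=[x_{ji}]$, where $x_{ji}\in\mathbb Z_{\ge0}$ is the number of times $a_i$ occurs as a diagonal block of $b_j$. Thus the standard unital *-homomorphisms $\mathcal A_r\to\mathcal A_{r+1}$ correspond bijectively to the $k\times k$ matrices $X$ with entries in $\mathbb Z_{\ge0}$ such that $X\mathbf n=\gamma_r\mathbf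 n$; they form a finite nonempty set $\mathcal E_r$. The ensemble is $\mathcal E(\mathbf n,\mathbf g)=\prod_{r=1}^\infty\mathcal E_r$. Its elements $(\phi_1,\phi_2,\dots)$ are called chains and are identified with direct sequences $\mathcal A_1\xrightarrow{\phi_1}\mathcal A_2\xrightarrow{\phi_2}\cdots$. The ensemble carries the product probability measure of the uniform probability measures on the finite sets $\mathcal E_r$. *)

theory Defs
  imports "HOL-Probability.Probability" "Jordan_Normal_Form.Schur_Decomposition"
begin

text \<open>
  An element of the direct sum of the full matrix algebras of sizes \<open>p 1, \<dots>, p k\<close> is a
  function on \<open>{1..k}\<close>, made extensional so that equality of elements is equality of functions.
\<close>

definition mat_sum :: "nat \<Rightarrow> (nat \<Rightarrow> nat) \<Rightarrow> (nat \<Rightarrow> complex mat) set" where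
  "mat_sum k p = (\<Pi>\<^sub>E i\<in>{1..k}. carrier_mat (p i) (p i))"

definition unital_star_hom ::
  "nat \<Rightarrow> (nat \<Rightarrow> nat) \<Rightarrow> nat \<Rightarrow> (nat \<Rightarrow> nat) \<Rightarrow>
    ((nat \<Rightarrow> complex mat) \<Rightarrow> (nat \<Rightarrow> complex mat)) \<Rightarrow> bool" where
  "unital_star_hom k p l q \<phi> \<longleftrightarrow>
     \<phi> \<in> mat_sum k p \<rightarrow>\<^sub>E mat_sum l q \<and>
     (\<forall>a\<in>mat_sum k p. \<forall>b\<in>mat_sum k p.
        \<phi> (\<lambda>i\<in>{1..k}. a i + b i) = (\<lambda>j\<in>{1..l}. \<phi> a j + \<phi> b j)) \<and>
     (\<forall>c. \<forall>a\<in>mat_sum k p.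
        \<phi> (\<lambda>i\<in>{1..k}. c \<cdot>\<^sub>m a i) = (\<lambda>j\<in>{1..l}. c \<cdot>\<^sub>m \<phi> a j)) \<and>
     (\<forall>a\<in>mat_sum k p. \<forall>b\<in>mat_sum k p.
        \<phi> (\<lambda>i\<in>{1..k}. a i * b i) = (\<lambda>j\<in>{1..l}. \<phi> a j * \<phi> b j)) \<and>
     (\<forall>a\<in>mat_sum k p.
        \<phi> (\<lambda>i\<in>{1..k}. mat_adjoint (a i)) = (\<lambda>j\<in>{1..l}. mat_adjoint (\<phi> a j))) \<and>
     \<phi> (\<lambda>i\<in>{1..k}. 1\<^sub>m (p i)) = (\<lambda>j\<in>{1..l}. 1\<^sub>m (q j))"

text \<open>
  The list \<open>s j\<close> contains the subscripts of the diagonal blocks of the \<open>j\<close>-th component from top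
  to bottom; it is nondecreasing and does not depend on the argument \<open>a\<close>. The partial multiplicity
  \<open>x\<^sub>j\<^sub>i\<close> is the number of occurrences of \<open>i\<close> in \<open>s j\<close>.
\<close>

definition standard_hom ::
  "nat \<Rightarrow> (nat \<Rightarrow> nat) \<Rightarrow> nat \<Rightarrow> (nat \<Rightarrow> nat) \<Rightarrow>
    ((nat \<Rightarrow> complex mat) \<Rightarrow> (nat \<Rightarrow> complex mat)) \<Rightarrow> bool" where
  "standard_hom k p l q \<phi> \<longleftrightarrow>
     unital_star_hom k p l q \<phi> \<and>
     (\<exists>s :: nat \<Rightarrow> nat list.
        (\<forall>j\<in>{1..l}. sorted (s j) \<and> set (s j) \<subseteq> {1..k}) \<and>
        (\<forall>a\<in>mat_sum k p. \<forall>j\<in>{1..l}. \<phi> a j = diag_block_mat (map a (s j))))"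

definition chain_algebra ::
  "nat \<Rightarrow> (nat \<Rightarrow> nat) \<Rightarrow> (nat \<Rightarrow> nat) \<Rightarrow> nat \<Rightarrow> (nat \<Rightarrow> complex mat) set" where
  "chain_algebra k n g r = mat_sum k (\<lambda>i. g r * n i)"

definition standard_homs ::
  "nat \<Rightarrow> (nat \<Rightarrow> nat) \<Rightarrow> (nat \<Rightarrow> nat) \<Rightarrow> nat \<Rightarrow>
    ((nat \<Rightarrow> complex mat) \<Rightarrow> (nat \<Rightarrow> complex mat)) set" where
  "standard_homs k n g r =
     {\<phi>. standard_hom k (\<lambda>i. g r * n i) k (\<lambda>i. g (Suc r) * n i) \<phi>}"

definition ensemble ::
  "nat \<Rightarrow> (nat \<Rightarrow> nat) \<Rightarrow> (nat \<Rightarrow> nat) \<Rightarrow>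
    (nat \<Rightarrow> (nat \<Rightarrow> complex mat) \<Rightarrow> (nat \<Rightarrow> complex mat)) measure" where
  "ensemble k n g = (\<Pi>\<^sub>M r\<in>{1..}. uniform_count_measure (standard_homs k n g r))"

end

theory Submission
  imports Defs
begin

text \<open>
  By the Borel--Cantelli lemma it suffices that the probabilities of the events
  "\<open>\<phi>\<^sub>r\<close> is not injective" are summable, and for this that they are at most a constant times
  \<open>\<gamma>\<^sub>r\<close> to the power \<open>-k\<close>.

  A standard homomorphism is determined by its rows of multiplicities. A row is recorded here as the
  multiset of the subscripts of its diagonal blocks, and row \<open>j\<close> ranges over all multisets over
  \<open>{1..k}\<close> of total weight \<open>\<gamma>\<^sub>r n\<^sub>j\<close>, where \<open>i\<close> has weight \<open>n\<^sub>i\<close>. The rows are chosen independently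
  of one another, so the uniform measure on homomorphisms is that on a product of \<open>k\<close> sets of
  multisets (\<open>bij_betw_block_hom\<close>). The homomorphism is injective as soon as every \<open>i\<close> occurs in
  some row (\<open>inj_on_block_hom\<close>), because \<open>a\<^sub>i\<close> can then be read off from the image.

  Fix \<open>i\<close>. That one row avoids \<open>i\<close> has probability at most a constant times \<open>1 / \<gamma>\<^sub>r\<close>
  (\<open>card_weight_msets_avoiding\<close>): a multiset that avoids \<open>i\<close> has some element \<open>m\<close> that carries at
  least the fraction \<open>1 / k\<close> of the weight, and \<open>w\<^sub>i\<close> copies of \<open>m\<close> can be traded for \<open>w\<^sub>m\<close> copies
  of \<open>i\<close> any number of times up to order \<open>\<gamma>\<^sub>r\<close>. The resulting multisets are all of the same
  weight, and \<open>m\<close> together with one of them determines the original multiset. Hence all \<open>k\<close> rows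
  avoid \<open>i\<close> with probability of order at most \<open>\<gamma>\<^sub>r\<close> to the power \<open>-k\<close>, and the union over the
  \<open>k\<close> choices of \<open>i\<close> changes only the constant.
\<close>

section \<open>Multisets of prescribed weight\<close>

definition weight_msets :: "'a set \<Rightarrow> ('a \<Rightarrow> nat) \<Rightarrow> nat \<Rightarrow> 'a multiset set" where
  "weight_msets I w N = {A. set_mset A \<subseteq> I \<and> (\<Sum>i\<in>#A. w i) = N}"

lemma finite_weight_msets:
  assumes "finite I" "\<And>i. i \<in> I \<Longrightarrow> 1 \<le> w i"
  shows "finite (weight_msets I w N)"
proof (rule finite_subset)
  show "weight_msets I w N \<subseteq> mset ` {xs. set xs \<subseteq> I \<and> length xs \<le> N}"
  proof
    fix A assume A: "A \<in> weight_msets I w N"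
    obtain xs where xs: "A = mset xs" by (metis ex_mset)
    have "length xs = (\<Sum>i\<in>#A. 1)" by (simp add: xs)
    also have "\<dots> \<le> (\<Sum>i\<in>#A. w i)"
      using A assms(2) by (intro sum_mset_mono) (auto simp: weight_msets_def)
    finally show "A \<in> mset ` {xs. set xs \<subseteq> I \<and> length xs \<le> N}"
      using A xs by (auto simp: weight_msets_def)
  qed
  show "finite (mset ` {xs. set xs \<subseteq> I \<and> length xs \<le> N})"
    using finite_lists_length_le[OF assms(1)] by simp
qed

lemma weight_msets_scale:
  assumes "c > 0"
  shows "weight_msets I (\<lambda>i. c * w i) (c * N) = weight_msets I w N"
proof -
  have "(\<Sum>i\<in>#A. c * w i) = c * N \<longleftrightarrow> (\<Sum>i\<in>#A. w i) = N" for A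
    using assms sum_mset_distrib_left[of c w A] by (metis mult_cancel1 less_irrefl)
  then show ?thesis unfolding weight_msets_def by simp
qed

lemma sum_mset_conv_sum:
  fixes w :: "'a \<Rightarrow> nat"
  assumes "finite I" "set_mset A \<subseteq> I"
  shows "(\<Sum>i\<in>#A. w i) = (\<Sum>i\<in>I. count A i * w i)"
  using assms(2)
proof (induction A)
  case (add x A)
  have "(\<Sum>i\<in>I. count (add_mset x A) i * w i)
      = (\<Sum>i\<in>I. (if i = x then w i else 0) + count A i * w i)"
    by (intro sum.cong) auto
  also have "\<dots> = w x + (\<Sum>i\<in>I. count A i * w i)"
    using add.prems assms(1) by (simp add: sum.distrib)
  finally show ?case using add by simp
qed simp

text \<open>
  Pigeonhole: the contributions of the elements of \<open>I\<close> to the weight add up to \<open>N\<close>.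
\<close>

lemma ex_heavy_element:
  assumes "finite I" "I \<noteq> {}" "A \<in> weight_msets I w N"
  shows "\<exists>m\<in>I. N \<le> card I * (count A m * w m)"
proof (rule ccontr)
  assume "\<not> ?thesis"
  then have less: "card I * (count A m * w m) < N" if "m \<in> I" for m
    using that by (meson not_le)
  have "card I * N = (\<Sum>m\<in>I. card I * (count A m * w m))"
    using assms sum_mset_conv_sum[of I A w]
    by (simp add: weight_msets_def sum_distrib_left)
  also have "\<dots> < (\<Sum>m\<in>I. N)"
    using assms less by (intro sum_strict_mono) auto
  finally show False by simp
qed

text \<open>
  The trade of \<open>t * w i\<close> copies of a heavy element \<open>m\<close> for \<open>t * w m\<close> copies of \<open>i\<close> keeps the weight
  \<open>N\<close>. It is possible for all \<open>t\<close> up to \<open>T = N div (card I * B\<^sup>2)\<close>. If \<open>i\<close> was absent before the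
  trade, then \<open>t\<close> is recovered from the multiplicity of \<open>i\<close> afterwards, once \<open>m\<close> is known, and the
  trade can be undone. So there are at least \<open>T + 1\<close> multisets of weight \<open>N\<close> for each one that
  avoids \<open>i\<close>, up to the factor \<open>card I\<close> for the choice of \<open>m\<close>.
\<close>

lemma card_weight_msets_avoiding:
  assumes fin: "finite I" and i: "i \<in> I"
    and pos: "\<And>i. i \<in> I \<Longrightarrow> 1 \<le> w i" and le: "\<And>i. i \<in> I \<Longrightarrow> w i \<le> B"
  shows "card {A \<in> weight_msets I w N. i \<notin># A} * N \<le> (card I * B)\<^sup>2 * card (weight_msets I w N)"
proof -
  define D where "D = {A \<in> weight_msets I w N. i \<notin># A}"
  define T where "T = N div (card I * B\<^sup>2)"
  define trade where "trade = (\<lambda>A m t. A - replicate_mset (t * w i) m + replicate_mset (t * w m) i)"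
  have "\<forall>A\<in>D. \<exists>m\<in>I. N \<le> card I * (count A m * w m)"
    using ex_heavy_element[OF fin] i by (auto simp: D_def)
  then obtain h where h: "\<And>A. A \<in> D \<Longrightarrow> h A \<in> I"
    and heavy: "\<And>A. A \<in> D \<Longrightarrow> N \<le> card I * (count A (h A) * w (h A))"
    by metis
  have I0: "card I > 0" using fin i by (auto simp: card_gt_0_iff)
  have B0: "B > 0" using pos[OF i] le[OF i] by simp
  have enough: "t * w i \<le> count A (h A)" if A: "A \<in> D" and t: "t \<le> T" for A t
  proof -
    have "w i * w (h A) \<le> B\<^sup>2"
      using le[OF i] le[OF h[OF A]] by (simp add: power2_eq_square mult_mono)
    then have "t * (w i * w (h A)) * card I \<le> T * B\<^sup>2 * card I"
      using t by (intro mult_mono) auto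
    also have "\<dots> \<le> N"
      by (metis T_def div_times_less_eq_dividend mult.assoc mult.commute)
    also have "\<dots> \<le> card I * (count A (h A) * w (h A))" by (rule heavy[OF A])
    finally have "(t * w i) * (w (h A) * card I) \<le> count A (h A) * (w (h A) * card I)"
      by (simp add: mult_ac)
    moreover have "w (h A) * card I > 0" using I0 pos[OF h[OF A]] by simp
    ultimately show ?thesis by simp
  qed
  have restore: "A = trade A m t - replicate_mset (t * w m) i + replicate_mset (t * w i) m"
    if "t * w i \<le> count A m" for A m t
    using that by (simp add: trade_def count_le_replicate_mset_subset_eq)
  have ne: "h A \<noteq> i" if "A \<in> D" "0 < N" for A
    using heavy[OF that(1)] that by (auto simp: D_def not_in_iff)
  have "card (D \<times> {..T}) \<le> card (weight_msets I w N \<times> I)"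
    \<comment> \<open>For \<open>N = 0\<close> the heavy element of the empty multiset can be \<open>i\<close> itself, and \<open>t\<close> is then not
        recovered from the multiplicity of \<open>i\<close>.\<close>
  proof (cases "N = 0")
    case True
    then have "T = 0" by (simp add: T_def)
    have "D \<subseteq> weight_msets I w N" by (auto simp: D_def)
    then have "card D \<le> card (weight_msets I w N)"
      using finite_weight_msets[OF fin pos] by (intro card_mono) auto
    moreover have "1 \<le> card I" using I0 by simp
    ultimately have "card D * 1 \<le> card (weight_msets I w N) * card I"
      by (rule mult_le_mono)
    with \<open>T = 0\<close> show ?thesis by (simp add: card_cartesian_product)
  next
    case False
    show ?thesis
    proof (rule card_inj_on_le)
      show "finite (weight_msets I w N \<times> I)"
        using fin finite_weight_msets[OF fin pos] by auto
      show "(\<lambda>(A, t). (trade A (h A) t, h A)) ` (D \<times> {..T}) \<subseteq> weight_msets I w N \<times> I"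
      proof (rule image_subsetI)
        fix P assume "P \<in> D \<times> {..T}"
        then obtain A t where P: "P = (A, t)" and A: "A \<in> D" and t: "t \<le> T" by auto
        have sub: "replicate_mset (t * w i) (h A) \<subseteq># A"
          using enough A t by (simp add: count_le_replicate_mset_subset_eq)
        have "set_mset (trade A (h A) t) \<subseteq> I"
          using A i by (auto simp: trade_def D_def weight_msets_def dest: in_diffD split: if_splits)
        moreover have "(\<Sum>i\<in>#trade A (h A) t. w i) = N"
        proof -
          have *: "(\<Sum>i\<in>#A. w i) = (\<Sum>i\<in>#A - replicate_mset (t * w i) (h A). w i) + t * w i * w (h A)"
            using arg_cong[OF subset_mset.diff_add[OF sub], of "\<lambda>A. \<Sum>i\<in>#A. w i"] by simp
          show ?thesis
            using * A by (simp add: trade_def D_def weight_msets_def mult_ac)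
        qed
        ultimately show "(case P of (A, t) \<Rightarrow> (trade A (h A) t, h A)) \<in> weight_msets I w N \<times> I"
          using h[OF A] by (simp add: weight_msets_def P)
      qed
      show "inj_on (\<lambda>(A, t). (trade A (h A) t, h A)) (D \<times> {..T})"
      proof (rule inj_onI)
        fix P P' assume "P \<in> D \<times> {..T}" "P' \<in> D \<times> {..T}"
          and img: "(case P of (A, t) \<Rightarrow> (trade A (h A) t, h A)) = (case P' of (A, t) \<Rightarrow> (trade A (h A) t, h A))"
        then obtain A t A' t' where P: "P = (A, t)" "P' = (A', t')"
          and A: "A \<in> D" "A' \<in> D" and t: "t \<le> T" "t' \<le> T"
          by auto
        have eq: "trade A (h A) t = trade A' (h A') t'" and h_eq: "h A = h A'"
          using img unfolding P prod.case prod.inject by blast+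
        have cnt: "count (trade A (h A) t) i = t * w (h A)" if "A \<in> D" for A t
          using that ne[OF that] False by (simp add: trade_def D_def not_in_iff)
        have "t * w (h A) = t' * w (h A)"
          using cnt[OF A(1), of t] cnt[OF A(2), of t'] eq h_eq by metis
        moreover have "w (h A) > 0" using pos[OF h[OF A(1)]] by simp
        ultimately have "t = t'" by simp
        moreover have "A = A'"
          using restore[OF enough[OF A(1)], of t] restore[OF enough[OF A(2)], of t'] t eq h_eq \<open>t = t'\<close>
          by simp
        ultimately show "P = P'" by (simp add: P)
      qed
    qed
  qed
  then have count: "card D * Suc T \<le> card (weight_msets I w N) * card I"
    by (simp add: card_cartesian_product)
  have "N \<le> Suc T * (card I * B\<^sup>2)"
    using I0 B0 unfolding T_def
    by (metis dividend_less_times_div less_imp_le mult.commute mult_Suc_right mult_pos_pos zero_less_power)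
  then have "card D * N \<le> card D * Suc T * (card I * B\<^sup>2)"
    by (metis mult.assoc mult_le_mono2)
  also have "\<dots> \<le> card (weight_msets I w N) * card I * (card I * B\<^sup>2)"
    using count by (rule mult_le_mono1)
  finally show ?thesis
    by (simp add: D_def power2_eq_square mult_ac)
qed

section \<open>The algebra of block diagonal matrices\<close>

lemma diag_block_mat_carrier:
  assumes "\<And>i. i \<in> set s \<Longrightarrow> a i \<in> carrier_mat (p i) (p i)"
  shows "diag_block_mat (map a s) \<in> carrier_mat (sum_list (map p s)) (sum_list (map p s))"
  using assms by (induction s) (auto simp: Let_def)

lemma diag_block_mat_add:
  fixes a b :: "'b \<Rightarrow> 'a :: monoid_add mat"
  assumes "\<And>i. i \<in> set s \<Longrightarrow> a i \<in> carrier_mat (p i) (p i)"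
    and "\<And>i. i \<in> set s \<Longrightarrow> b i \<in> carrier_mat (p i) (p i)"
  shows "diag_block_mat (map (\<lambda>i. a i + b i) s) = diag_block_mat (map a s) + diag_block_mat (map b s)"
  using assms
proof (induction s)
  case (Cons i s)
  let ?m = "sum_list (map p s)"
  have A: "diag_block_mat (map a s) \<in> carrier_mat ?m ?m" and B: "diag_block_mat (map b s) \<in> carrier_mat ?m ?m"
    using Cons.prems by (auto intro!: diag_block_mat_carrier)
  have a: "a i \<in> carrier_mat (p i) (p i)" and b: "b i \<in> carrier_mat (p i) (p i)"
    using Cons.prems by auto
  have IH: "diag_block_mat (map (\<lambda>i. a i + b i) s) = diag_block_mat (map a s) + diag_block_mat (map b s)"
    using Cons by auto
  show ?case
    using A B a b by (auto simp: Let_def IH add_four_block_mat[where ?nr1.0="p i" and ?nc1.0="p i" and ?nr2.0="?m" and ?nc2.0="?m"])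
qed auto

lemma diag_block_mat_smult:
  fixes a :: "'b \<Rightarrow> 'a :: semiring_0 mat"
  assumes "\<And>i. i \<in> set s \<Longrightarrow> a i \<in> carrier_mat (p i) (p i)"
  shows "diag_block_mat (map (\<lambda>i. c \<cdot>\<^sub>m a i) s) = c \<cdot>\<^sub>m diag_block_mat (map a s)"
  using assms
proof (induction s)
  case (Cons i s)
  let ?m = "sum_list (map p s)"
  have A: "diag_block_mat (map a s) \<in> carrier_mat ?m ?m"
    using Cons.prems by (auto intro!: diag_block_mat_carrier)
  have a: "a i \<in> carrier_mat (p i) (p i)"
    using Cons.prems by auto
  have IH: "diag_block_mat (map (\<lambda>i. c \<cdot>\<^sub>m a i) s) = c \<cdot>\<^sub>m diag_block_mat (map a s)"
    using Cons by auto
  show ?case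
    using A a by (intro eq_matI) (auto simp: Let_def IH)
qed auto

lemma diag_block_mat_mult:
  fixes a b :: "'b \<Rightarrow> 'a :: semiring_0 mat"
  assumes "\<And>i. i \<in> set s \<Longrightarrow> a i \<in> carrier_mat (p i) (p i)"
    and "\<And>i. i \<in> set s \<Longrightarrow> b i \<in> carrier_mat (p i) (p i)"
  shows "diag_block_mat (map (\<lambda>i. a i * b i) s) = diag_block_mat (map a s) * diag_block_mat (map b s)"
  using assms
proof (induction s)
  case (Cons i s)
  let ?m = "sum_list (map p s)"
  have A: "diag_block_mat (map a s) \<in> carrier_mat ?m ?m" and B: "diag_block_mat (map b s) \<in> carrier_mat ?m ?m"
    using Cons.prems by (auto intro!: diag_block_mat_carrier)
  have a: "a i \<in> carrier_mat (p i) (p i)" and b: "b i \<in> carrier_mat (p i) (p i)"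
    using Cons.prems by auto
  have IH: "diag_block_mat (map (\<lambda>i. a i * b i) s) = diag_block_mat (map a s) * diag_block_mat (map b s)"
    using Cons by auto
  have "a i * b i \<in> carrier_mat (p i) (p i)"
       "diag_block_mat (map a s) * diag_block_mat (map b s) \<in> carrier_mat ?m ?m"
    using A B a b by auto
  then show ?case
    using A B a b
    by (simp add: Let_def IH mult_four_block_mat[where ?nr1.0="p i" and ?n1.0="p i" and ?nc1.0="p i"
          and ?nr2.0="?m" and ?n2.0="?m" and ?nc2.0="?m"])
qed auto

lemma mat_adjoint_carrier:
  "A \<in> carrier_mat r c \<Longrightarrow> mat_adjoint A \<in> carrier_mat c r"
  by (auto simp: mat_adjoint_def)

lemma mat_adjoint_index:
  assumes "i < dim_col A" "j < dim_row A"
  shows "mat_adjoint A $$ (i, j) = conjugate (A $$ (j, i))"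
  using assms by (simp add: mat_adjoint_def mat_of_rows_index)

lemma diag_block_mat_adjoint:
  assumes "\<And>i. i \<in> set s \<Longrightarrow> a i \<in> carrier_mat (p i) (p i)"
  shows "diag_block_mat (map (\<lambda>i. mat_adjoint (a i)) s) = mat_adjoint (diag_block_mat (map a s))"
  using assms
proof (induction s)
  case Nil
  show ?case by (rule eq_matI) (auto simp: mat_adjoint_def)
next
  case (Cons i s)
  let ?m = "sum_list (map p s)"
  have A: "diag_block_mat (map a s) \<in> carrier_mat ?m ?m"
    using Cons.prems by (auto intro!: diag_block_mat_carrier)
  have a: "a i \<in> carrier_mat (p i) (p i)"
    using Cons.prems by auto
  have IH: "diag_block_mat (map (\<lambda>i. mat_adjoint (a i)) s) = mat_adjoint (diag_block_mat (map a s))"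
    using Cons by auto
  have dims: "dim_row (mat_adjoint (a i)) = p i" "dim_col (mat_adjoint (a i)) = p i"
    "dim_row (mat_adjoint (diag_block_mat (map a s))) = ?m"
    "dim_col (mat_adjoint (diag_block_mat (map a s))) = ?m"
    using mat_adjoint_carrier[OF a] mat_adjoint_carrier[OF A] by auto
  have carr: "diag_block_mat (map a (i # s)) \<in> carrier_mat (p i + ?m) (p i + ?m)"
    using diag_block_mat_carrier[of "i # s" a p] Cons.prems by simp
  note dims' = mat_adjoint_carrier[OF carr]
  show ?case
  proof (rule eq_matI)
    show "dim_row (diag_block_mat (map (\<lambda>i. mat_adjoint (a i)) (i # s)))
        = dim_row (mat_adjoint (diag_block_mat (map a (i # s))))"
      using dims' dims by (simp add: Let_def IH)
    show "dim_col (diag_block_mat (map (\<lambda>i. mat_adjoint (a i)) (i # s)))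
        = dim_col (mat_adjoint (diag_block_mat (map a (i # s))))"
      using dims' dims by (simp add: Let_def IH)
    fix x y
    assume "x < dim_row (mat_adjoint (diag_block_mat (map a (i # s))))"
       "y < dim_col (mat_adjoint (diag_block_mat (map a (i # s))))"
    then have xy: "x < p i + ?m" "y < p i + ?m" using dims' by auto
    have "mat_adjoint (diag_block_mat (map a (i # s))) $$ (x, y)
        = conjugate (diag_block_mat (map a (i # s)) $$ (y, x))"
      using xy carr by (intro mat_adjoint_index) auto
    also have "\<dots> = diag_block_mat (map (\<lambda>i. mat_adjoint (a i)) (i # s)) $$ (x, y)"
      using xy A a dims by (auto simp: Let_def IH mat_adjoint_index)
    finally show "diag_block_mat (map (\<lambda>i. mat_adjoint (a i)) (i # s)) $$ (x, y)
        = mat_adjoint (diag_block_mat (map a (i # s))) $$ (x, y)" ..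
  qed
qed

lemma diag_block_mat_one:
  "diag_block_mat (map (\<lambda>i. 1\<^sub>m (p i)) s) = 1\<^sub>m (sum_list (map p s))"
  by (induction s) (auto simp: Let_def)

lemma diag_block_mat_Cons_inject:
  assumes eq: "diag_block_mat (A # As) = diag_block_mat (B # Bs)"
    and dim: "dim_row A = dim_row B" "dim_col A = dim_col B"
  shows "A = B" and "diag_block_mat As = diag_block_mat Bs"
proof -
  let ?C = "diag_block_mat As" and ?D = "diag_block_mat Bs"
  have eq': "four_block_mat A (0\<^sub>m (dim_row A) (dim_col ?C)) (0\<^sub>m (dim_row ?C) (dim_col A)) ?C =
      four_block_mat B (0\<^sub>m (dim_row B) (dim_col ?D)) (0\<^sub>m (dim_row ?D) (dim_col B)) ?D" (is "?L = ?R")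
    using eq by (simp add: Let_def)
  have dim': "dim_row ?C = dim_row ?D" "dim_col ?C = dim_col ?D"
    using arg_cong[OF eq', of dim_row] arg_cong[OF eq', of dim_col] dim by auto
  show "A = B"
  proof (rule eq_matI)
    fix x y assume "x < dim_row B" "y < dim_col B"
    then show "A $$ (x, y) = B $$ (x, y)"
      using arg_cong[OF eq', of "\<lambda>M. M $$ (x, y)"] dim dim' by simp
  qed (use dim in auto)
  show "?C = ?D"
  proof (rule eq_matI)
    fix x y assume "x < dim_row ?D" "y < dim_col ?D"
    then show "?C $$ (x, y) = ?D $$ (x, y)"
      using arg_cong[OF eq', of "\<lambda>M. M $$ (dim_row B + x, dim_col B + y)"] dim dim' by simp
  qed (use dim' in auto)
qed

lemma diag_block_mat_map_inject:
  assumes "diag_block_mat (map a s) = diag_block_mat (map b s)"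
    and "\<And>i. i \<in> set s \<Longrightarrow> a i \<in> carrier_mat (p i) (p i)"
    and "\<And>i. i \<in> set s \<Longrightarrow> b i \<in> carrier_mat (p i) (p i)"
    and "i \<in> set s"
  shows "a i = b i"
  using assms
proof (induction s)
  case (Cons x s)
  have dim: "dim_row (a x) = dim_row (b x)" "dim_col (a x) = dim_col (b x)"
    using Cons.prems(2,3)[of x] by auto
  have eq: "diag_block_mat (a x # map a s) = diag_block_mat (b x # map b s)"
    using Cons.prems(1) by (simp only: list.map)
  note inj = diag_block_mat_Cons_inject[OF eq dim]
  show ?case
  proof (cases "i = x")
    case False
    then have "i \<in> set s" using Cons.prems(4) by simp
    then show ?thesis using Cons.IH[OF inj(2)] Cons.prems(2,3) by simp
  qed (simp add: inj(1))
qed auto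

text \<open>
  The sequence of block positions can be read off from the map it induces: if \<open>x\<close> and \<open>y\<close> are
  distinct first subscripts, the central projection onto the summand \<open>x\<close> has entry 1 at the top left
  corner of one image and 0 at that of the other. Since \<open>p i \<ge> 1\<close>, this corner exists and no block
  is invisible.
\<close>

lemma diag_block_mat_list_inject:
  assumes "\<And>a. a \<in> mat_sum k p \<Longrightarrow> diag_block_mat (map a s) = diag_block_mat (map a s')"
    and "set s \<subseteq> {1..k}" "set s' \<subseteq> {1..k}" and pos: "\<And>i. i \<in> {1..k} \<Longrightarrow> 1 \<le> p i"
  shows "s = s'"
  using assms(1-3)
proof (induction s arbitrary: s')
  case Nil
  show ?case
  proof (cases s')
    case (Cons x t)
    let ?a = "\<lambda>i\<in>{1..k}. 1\<^sub>m (p i) :: complex mat"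
    have "?a \<in> mat_sum k p" by (auto simp: mat_sum_def)
    from arg_cong[OF Nil.prems(1)[OF this], of dim_row] show ?thesis
      using Cons Nil.prems(3) pos[of x] by (auto simp: Let_def)
  qed simp
next
  case (Cons x s)
  show ?case
  proof (cases s')
    case Nil
    let ?a = "\<lambda>i\<in>{1..k}. 1\<^sub>m (p i) :: complex mat"
    have "?a \<in> mat_sum k p" by (auto simp: mat_sum_def)
    from arg_cong[OF Cons.prems(1)[OF this], of dim_row] show ?thesis
      using Nil Cons.prems(2) pos[of x] by (auto simp: Let_def)
  next
    case s': (Cons y t)
    have x: "x \<in> {1..k}" and y: "y \<in> {1..k}" using Cons.prems s' by auto
    have "x = y"
    proof (rule ccontr)
      assume "x \<noteq> y"
      let ?a = "\<lambda>i\<in>{1..k}. if i = x then 1\<^sub>m (p i) else 0\<^sub>m (p i) (p i) :: complex mat"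
      have "?a \<in> mat_sum k p" by (auto simp: mat_sum_def)
      from arg_cong[OF Cons.prems(1)[OF this], of "\<lambda>M. M $$ (0, 0)"] show False
        using x y pos[OF x] pos[OF y] s' \<open>x \<noteq> y\<close> by (auto simp: Let_def)
    qed
    moreover have "s = t"
    proof (rule Cons.IH)
      fix a assume "a \<in> mat_sum k p"
      from Cons.prems(1)[OF this]
      have "diag_block_mat (a x # map a s) = diag_block_mat (a x # map a t)"
        unfolding s' \<open>x = y\<close> list.map .
      then show "diag_block_mat (map a s) = diag_block_mat (map a t)"
        by (rule diag_block_mat_Cons_inject(2)) simp_all
    qed (use Cons.prems s' in auto)
    ultimately show ?thesis using s' by simp
  qed
qed

section \<open>Standard homomorphisms and their multiplicities\<close>

text \<open>
  The standard homomorphism whose multiplicity \<open>x\<^sub>j\<^sub>i\<close> is \<open>count (A j) i\<close>. Sorting the multiset yields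
  the increasing order of the blocks, so a multiset carries the same information as a row of the
  multiplicity matrix and is directly a domain on which to count.
\<close>

definition block_hom ::
  "nat \<Rightarrow> (nat \<Rightarrow> nat) \<Rightarrow> nat \<Rightarrow> (nat \<Rightarrow> nat multiset) \<Rightarrow> (nat \<Rightarrow> complex mat) \<Rightarrow> (nat \<Rightarrow> complex mat)" where
  "block_hom k p l A = (\<lambda>a\<in>mat_sum k p. \<lambda>j\<in>{1..l}. diag_block_mat (map a (sorted_list_of_multiset (A j))))"

lemma sum_list_map_sorted_list_of_multiset:
  "sum_list (map w (sorted_list_of_multiset A)) = (\<Sum>i\<in>#A. w i)"
  for w :: "'a :: linorder \<Rightarrow> nat"
  by (metis mset_map mset_sorted_list_of_multiset sum_mset_sum_list)

lemma standard_hom_block_hom: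
  assumes A: "A \<in> (\<Pi>\<^sub>E j\<in>{1..l}. weight_msets {1..k} p (q j))"
  shows "standard_hom k p l q (block_hom k p l A)"
proof -
  let ?s = "\<lambda>j. sorted_list_of_multiset (A j)"
  have s: "set (?s j) \<subseteq> {1..k}" and size: "sum_list (map p (?s j)) = q j" if "j \<in> {1..l}" for j
    using A that by (auto simp: weight_msets_def PiE_iff sum_list_map_sorted_list_of_multiset)
  have carr: "a i \<in> carrier_mat (p i) (p i)" if "a \<in> mat_sum k p" "j \<in> {1..l}" "i \<in> set (?s j)" for a i j
    using that s by (auto simp: mat_sum_def)
  have eval: "block_hom k p l A a = (\<lambda>j\<in>{1..l}. diag_block_mat (map a (?s j)))" if "a \<in> mat_sum k p" for a
    using that by (simp add: block_hom_def)
  have eval_restrict: "block_hom k p l A (\<lambda>i\<in>{1..k}. f i) = (\<lambda>j\<in>{1..l}. diag_block_mat (map f (?s j)))"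
    if "\<And>i. i \<in> {1..k} \<Longrightarrow> f i \<in> carrier_mat (p i) (p i)" for f
  proof -
    have "map (restrict f {1..k}) (?s j) = map f (?s j)" if "j \<in> {1..l}" for j
      using s[OF that] by auto
    note blocks = arg_cong[OF this, of _ diag_block_mat]
    have "(\<lambda>i\<in>{1..k}. f i) \<in> mat_sum k p"
      using that by (auto simp: mat_sum_def)
    show ?thesis
      unfolding eval[OF \<open>(\<lambda>i\<in>{1..k}. f i) \<in> mat_sum k p\<close>]
      by (rule restrict_ext) (rule blocks)
  qed
  have mat: "a i \<in> carrier_mat (p i) (p i)" if "a \<in> mat_sum k p" "i \<in> {1..k}" for a i
    using that by (auto simp: mat_sum_def)
  have "unital_star_hom k p l q (block_hom k p l A)"
    unfolding unital_star_hom_def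
  proof (intro conjI ballI allI)
    show "block_hom k p l A \<in> mat_sum k p \<rightarrow>\<^sub>E mat_sum l q"
    proof (rule PiE_I)
      fix a assume a: "a \<in> mat_sum k p"
      have "diag_block_mat (map a (?s j)) \<in> carrier_mat (q j) (q j)" if "j \<in> {1..l}" for j
        using diag_block_mat_carrier[of "?s j" a p] carr[OF a that] size[OF that] by simp
      then show "block_hom k p l A a \<in> mat_sum l q"
        unfolding eval[OF a] unfolding mat_sum_def by auto
    qed (simp add: block_hom_def)
  next
    fix a b assume ab: "a \<in> mat_sum k p" "b \<in> mat_sum k p"
    show "block_hom k p l A (\<lambda>i\<in>{1..k}. a i + b i)
        = (\<lambda>j\<in>{1..l}. block_hom k p l A a j + block_hom k p l A b j)"
      using ab by (subst eval_restrict[OF add_carrier_mat[OF mat[OF ab(2)]]])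
        (auto simp: eval intro!: restrict_ext diag_block_mat_add[where p=p] carr)
    show "block_hom k p l A (\<lambda>i\<in>{1..k}. a i * b i)
        = (\<lambda>j\<in>{1..l}. block_hom k p l A a j * block_hom k p l A b j)"
      using ab by (subst eval_restrict[OF mult_carrier_mat[OF mat[OF ab(1)] mat[OF ab(2)]]])
        (auto simp: eval intro!: restrict_ext diag_block_mat_mult[where p=p] carr)
  next
    fix a c assume a: "a \<in> mat_sum k p"
    show "block_hom k p l A (\<lambda>i\<in>{1..k}. c \<cdot>\<^sub>m a i) = (\<lambda>j\<in>{1..l}. c \<cdot>\<^sub>m block_hom k p l A a j)"
      using a by (subst eval_restrict[OF smult_carrier_mat[OF mat[OF a]]])
        (auto simp: eval intro!: restrict_ext diag_block_mat_smult[where p=p] carr)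
  next
    fix a assume a: "a \<in> mat_sum k p"
    show "block_hom k p l A (\<lambda>i\<in>{1..k}. mat_adjoint (a i)) = (\<lambda>j\<in>{1..l}. mat_adjoint (block_hom k p l A a j))"
      using a by (subst eval_restrict[OF mat_adjoint_carrier[OF mat[OF a]]])
        (auto simp: eval intro!: restrict_ext diag_block_mat_adjoint[where p=p] carr)
  next
    show "block_hom k p l A (\<lambda>i\<in>{1..k}. 1\<^sub>m (p i)) = (\<lambda>j\<in>{1..l}. 1\<^sub>m (q j))"
      by (subst eval_restrict) (auto simp: diag_block_mat_one size intro!: restrict_ext)
  qed
  moreover have "\<forall>j\<in>{1..l}. sorted (?s j) \<and> set (?s j) \<subseteq> {1..k}"
    using s by simp
  moreover have "\<forall>a\<in>mat_sum k p. \<forall>j\<in>{1..l}. block_hom k p l A a j = diag_block_mat (map a (?s j))"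
    by (simp add: eval)
  ultimately show ?thesis
    unfolding standard_hom_def by (intro conjI exI[of _ ?s])
qed

text \<open>
  The weight of the row \<open>j\<close> comes from unitality: the image of the unit is the identity matrix of size
  \<open>q j\<close>, while its diagonal blocks have sizes \<open>p i\<close>.
\<close>

lemma standard_hom_imp_block_hom:
  assumes "standard_hom k p l q \<phi>"
  shows "\<exists>A \<in> (\<Pi>\<^sub>E j\<in>{1..l}. weight_msets {1..k} p (q j)). \<phi> = block_hom k p l A"
proof -
  obtain s where hom: "unital_star_hom k p l q \<phi>"
    and s: "\<And>j. j \<in> {1..l} \<Longrightarrow> sorted (s j) \<and> set (s j) \<subseteq> {1..k}"
    and \<phi>: "\<And>a j. a \<in> mat_sum k p \<Longrightarrow> j \<in> {1..l} \<Longrightarrow> \<phi> a j = diag_block_mat (map a (s j))"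
    using assms unfolding standard_hom_def by blast
  have Pi: "\<phi> \<in> mat_sum k p \<rightarrow>\<^sub>E mat_sum l q"
    and one: "\<phi> (\<lambda>i\<in>{1..k}. 1\<^sub>m (p i)) = (\<lambda>j\<in>{1..l}. 1\<^sub>m (q j))"
    using hom by (auto simp: unital_star_hom_def)
  define A where "A = (\<lambda>j\<in>{1..l}. mset (s j))"
  have "sum_list (map p (s j)) = q j" if j: "j \<in> {1..l}" for j
  proof -
    have "map (\<lambda>i\<in>{1..k}. 1\<^sub>m (p i)) (s j) = map (\<lambda>i. 1\<^sub>m (p i) :: complex mat) (s j)"
      using s[OF j] by auto
    then have "diag_block_mat (map (\<lambda>i\<in>{1..k}. 1\<^sub>m (p i)) (s j))
        = (1\<^sub>m (sum_list (map p (s j))) :: complex mat)"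
      by (simp only: diag_block_mat_one)
    moreover have "(\<lambda>i\<in>{1..k}. 1\<^sub>m (p i)) \<in> mat_sum k p"
      by (auto simp: mat_sum_def)
    ultimately have "1\<^sub>m (q j) = (1\<^sub>m (sum_list (map p (s j))) :: complex mat)"
      using \<phi>[of "\<lambda>i\<in>{1..k}. 1\<^sub>m (p i)" j] one j by simp
    then show ?thesis by (metis index_one_mat(2))
  qed
  then have A: "A \<in> (\<Pi>\<^sub>E j\<in>{1..l}. weight_msets {1..k} p (q j))"
    using s by (auto simp: A_def weight_msets_def sum_mset_sum_list simp flip: mset_map)
  have "\<phi> = block_hom k p l A"
  proof (rule PiE_ext[OF Pi])
    show Pi': "block_hom k p l A \<in> mat_sum k p \<rightarrow>\<^sub>E mat_sum l q"
      using standard_hom_block_hom[OF A] by (simp add: standard_hom_def unital_star_hom_def)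
    fix a assume a: "a \<in> mat_sum k p"
    have "\<phi> a \<in> mat_sum l q" "block_hom k p l A a \<in> mat_sum l q"
      using Pi Pi' a by auto
    then show "\<phi> a = block_hom k p l A a"
      unfolding mat_sum_def
    proof (rule PiE_ext)
      fix j assume j: "j \<in> {1..l}"
      have "sorted_list_of_multiset (A j) = s j"
        using j s[OF j] by (simp add: A_def sort_key_id_if_sorted sorted_sort_id)
      then show "\<phi> a j = block_hom k p l A a j"
        using a j by (simp add: block_hom_def \<phi>)
    qed
  qed
  with A show ?thesis by blast
qed

text \<open>
  Injectivity is needed as well as surjectivity: it turns the count of multisets into a lower bound for
  the number of all homomorphisms, the denominator of the probability in question.
\<close>

lemma bij_betw_block_hom:
  assumes pos: "\<And>i. i \<in> {1..k} \<Longrightarrow> 1 \<le> p i"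
  shows "bij_betw (block_hom k p l) (\<Pi>\<^sub>E j\<in>{1..l}. weight_msets {1..k} p (q j)) {\<phi>. standard_hom k p l q \<phi>}"
  unfolding bij_betw_def
proof
  show "inj_on (block_hom k p l) (\<Pi>\<^sub>E j\<in>{1..l}. weight_msets {1..k} p (q j))"
  proof (rule inj_onI, rule PiE_ext)
    fix A A' j
    assume A: "A \<in> (\<Pi>\<^sub>E j\<in>{1..l}. weight_msets {1..k} p (q j))"
      "A' \<in> (\<Pi>\<^sub>E j\<in>{1..l}. weight_msets {1..k} p (q j))"
      and eq: "block_hom k p l A = block_hom k p l A'" and j: "j \<in> {1..l}"
    have "sorted_list_of_multiset (A j) = sorted_list_of_multiset (A' j)"
    proof (rule diag_block_mat_list_inject[OF _ _ _ pos])
      fix a assume "a \<in> mat_sum k p"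
      then show "diag_block_mat (map a (sorted_list_of_multiset (A j)))
          = diag_block_mat (map a (sorted_list_of_multiset (A' j)))"
        using fun_cong[OF fun_cong[OF eq, of a], of j] j by (simp add: block_hom_def)
    qed (use A j in \<open>auto simp: weight_msets_def PiE_iff\<close>)
    then show "A j = A' j" by (metis mset_sorted_list_of_multiset)
  qed
  show "block_hom k p l ` (\<Pi>\<^sub>E j\<in>{1..l}. weight_msets {1..k} p (q j)) = {\<phi>. standard_hom k p l q \<phi>}"
  proof (rule Set.set_eqI)
    fix \<phi>
    show "\<phi> \<in> block_hom k p l ` (\<Pi>\<^sub>E j\<in>{1..l}. weight_msets {1..k} p (q j))
        \<longleftrightarrow> \<phi> \<in> {\<phi>. standard_hom k p l q \<phi>}"
      using standard_hom_block_hom[of _ l k p q] standard_hom_imp_block_hom[of k p l q \<phi>]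
      by (auto simp only: image_iff mem_Collect_eq)
  qed
qed

lemma inj_on_block_hom:
  assumes A: "\<And>j. j \<in> {1..l} \<Longrightarrow> set_mset (A j) \<subseteq> {1..k}"
    and occurs: "\<And>i. i \<in> {1..k} \<Longrightarrow> \<exists>j\<in>{1..l}. i \<in># A j"
  shows "inj_on (block_hom k p l A) (mat_sum k p)"
proof (rule inj_onI)
  fix a b assume ab: "a \<in> mat_sum k p" "b \<in> mat_sum k p" and eq: "block_hom k p l A a = block_hom k p l A b"
  show "a = b"
  proof (rule PiE_ext[OF ab[unfolded mat_sum_def]])
    fix i assume "i \<in> {1..k}"
    then obtain j where j: "j \<in> {1..l}" "i \<in># A j" using occurs by blast
    have "diag_block_mat (map a (sorted_list_of_multiset (A j)))
        = diag_block_mat (map b (sorted_list_of_multiset (A j)))"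
      using fun_cong[OF eq, of j] ab j by (simp add: block_hom_def)
    then show "a i = b i"
      by (rule diag_block_mat_map_inject[where p=p]) (use ab j A[OF j(1)] in \<open>auto simp: mat_sum_def\<close>)
  qed
qed

section \<open>Probability of a non-injective step\<close>

lemma finite_standard_homs:
  assumes "\<And>i. i \<in> {1..k} \<Longrightarrow> 1 \<le> p i"
  shows "finite {\<phi>. standard_hom k p l q \<phi>}"
proof -
  have "finite (\<Pi>\<^sub>E j\<in>{1..l}. weight_msets {1..k} p (q j))"
    using assms by (intro finite_PiE finite_weight_msets) auto
  then show ?thesis
    using bij_betw_finite[OF bij_betw_block_hom[OF assms, where l=l and q=q]] by simp
qed

text \<open>
  A union bound over the subscript \<open>i\<close> missing from all rows. For fixed \<open>i\<close> the count factors over the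
  rows, and each of the \<open>l\<close> rows contributes a factor at most \<open>(k * B)\<^sup>2 / G\<close> to the proportion. Dividing
  all block sizes by \<open>c\<close> turns the admissible rows into multisets with the weights \<open>n i\<close>.
\<close>

lemma card_non_injective_standard_homs:
  fixes k l c B :: nat and n N :: "nat \<Rightarrow> nat"
  assumes c: "c > 0"
    and n: "\<And>i. i \<in> {1..k} \<Longrightarrow> 1 \<le> n i" and B: "\<And>i. i \<in> {1..k} \<Longrightarrow> n i \<le> B"
    and N: "\<And>j. j \<in> {1..l} \<Longrightarrow> G \<le> N j"
  defines "E \<equiv> {\<phi>. standard_hom k (\<lambda>i. c * n i) l (\<lambda>j. c * N j) \<phi>}"
  shows "card {\<phi> \<in> E. \<not> inj_on \<phi> (mat_sum k (\<lambda>i. c * n i))} * G ^ l \<le> k * (k * B) ^ (2 * l) * card E"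
proof -
  let ?p = "\<lambda>i. c * n i"
  let ?W = "\<lambda>j. weight_msets {1..k} n (N j)"
  let ?Z = "\<lambda>i. \<Pi>\<^sub>E j\<in>{1..l}. {A \<in> ?W j. i \<notin># A}"
  have fin: "finite (?W j)" for j using n by (intro finite_weight_msets) auto
  have bij: "bij_betw (block_hom k ?p l) (\<Pi>\<^sub>E j\<in>{1..l}. ?W j) E"
    using bij_betw_block_hom[of k ?p l "\<lambda>j. c * N j"] n c
    by (simp add: weight_msets_scale E_def)
  have "{\<phi> \<in> E. \<not> inj_on \<phi> (mat_sum k ?p)} \<subseteq> (\<Union>i\<in>{1..k}. block_hom k ?p l ` ?Z i)"
  proof clarify
    fix \<phi> assume "\<phi> \<in> E" and ninj: "\<not> inj_on \<phi> (mat_sum k ?p)"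
    then obtain A where A: "A \<in> (\<Pi>\<^sub>E j\<in>{1..l}. ?W j)" and \<phi>: "\<phi> = block_hom k ?p l A"
      using bij by (auto simp: bij_betw_def)
    have "set_mset (A j) \<subseteq> {1..k}" if "j \<in> {1..l}" for j
      using A that by (auto simp: weight_msets_def PiE_iff)
    then obtain i where i: "i \<in> {1..k}" and "\<And>j. j \<in> {1..l} \<Longrightarrow> i \<notin># A j"
      using inj_on_block_hom[of l A k ?p] ninj \<phi> by blast
    then have "A \<in> ?Z i"
      using A by (auto simp: PiE_iff)
    then show "\<phi> \<in> (\<Union>i\<in>{1..k}. block_hom k ?p l ` ?Z i)"
      using i unfolding \<phi> by (intro UN_I imageI)
  qed
  then have "card {\<phi> \<in> E. \<not> inj_on \<phi> (mat_sum k ?p)} \<le> card (\<Union>i\<in>{1..k}. block_hom k ?p l ` ?Z i)"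
    using fin by (intro card_mono finite_UN_I finite_imageI finite_PiE) auto
  also have "\<dots> \<le> (\<Sum>i\<in>{1..k}. card (block_hom k ?p l ` ?Z i))"
    by (rule card_UN_le) simp
  also have "\<dots> \<le> (\<Sum>i\<in>{1..k}. card (?Z i))"
    using fin by (intro sum_mono card_image_le finite_PiE) auto
  finally have "card {\<phi> \<in> E. \<not> inj_on \<phi> (mat_sum k ?p)} * G ^ l \<le> (\<Sum>i\<in>{1..k}. card (?Z i)) * G ^ l"
    by (rule mult_le_mono1)
  also have "\<dots> = (\<Sum>i\<in>{1..k}. card (?Z i) * G ^ l)"
    by (rule sum_distrib_right)
  also have "\<dots> \<le> (\<Sum>i\<in>{1..k}. (k * B) ^ (2 * l) * card E)"
  proof (rule sum_mono)
    fix i assume i: "i \<in> {1..k}"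
    have "card (?Z i) * G ^ l = (\<Prod>j\<in>{1..l}. card {A \<in> ?W j. i \<notin># A} * G)"
      by (simp add: card_PiE prod.distrib)
    also have "\<dots> \<le> (\<Prod>j\<in>{1..l}. (k * B)\<^sup>2 * card (?W j))"
    proof (rule prod_mono, intro conjI)
      fix j assume j: "j \<in> {1..l}"
      have "card {A \<in> ?W j. i \<notin># A} * G \<le> card {A \<in> ?W j. i \<notin># A} * N j"
        using N[OF j] by simp
      also have "\<dots> \<le> (k * B)\<^sup>2 * card (?W j)"
        using card_weight_msets_avoiding[of "{1..k}" i n B "N j"] i n B by simp
      finally show "card {A \<in> ?W j. i \<notin># A} * G \<le> (k * B)\<^sup>2 * card (?W j)" .
    qed simp
    also have "\<dots> = (k * B) ^ (2 * l) * card E"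
      using bij_betw_same_card[OF bij] by (simp add: card_PiE prod.distrib power_mult)
    finally show "card (?Z i) * G ^ l \<le> (k * B) ^ (2 * l) * card E" .
  qed
  also have "\<dots> = k * (k * B) ^ (2 * l) * card E" by simp
  finally show ?thesis .
qed

text \<open>
  Take \<open>d\<close> copies of \<open>a\<^sub>j\<close> as the \<open>j\<close>-th component.
\<close>

lemma standard_homs_nonempty:
  assumes "d > 0" "c > 0"
  shows "{\<phi>. standard_hom k (\<lambda>i. c * n i) k (\<lambda>j. c * (d * n j)) \<phi>} \<noteq> {}"
proof -
  have "(\<lambda>j\<in>{1..k}. replicate_mset d j) \<in> (\<Pi>\<^sub>E j\<in>{1..k}. weight_msets {1..k} (\<lambda>i. c * n i) (c * (d * n j)))"
    using assms by (auto simp: weight_msets_def mult_ac)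
  from standard_hom_block_hom[OF this] show ?thesis by blast
qed

text \<open>
  The Borel--Cantelli lemma for coordinatewise events in an infinite product of uniform measures: each
  coordinate projection pushes the product measure to its factor, so the measure of the event at
  coordinate \<open>r\<close> is a proportion of elements of \<open>S r\<close>. The coordinates start at 1, hence the shift by
  \<open>Suc\<close> to sequences indexed from 0.
\<close>

lemma
  fixes S :: "nat \<Rightarrow> 'a set" and Q :: "nat \<Rightarrow> 'a \<Rightarrow> bool"
  assumes fin: "\<And>r. r \<in> {1..} \<Longrightarrow> finite (S r)" and ne: "\<And>r. r \<in> {1..} \<Longrightarrow> S r \<noteq> {}"
    and summable: "summable (\<lambda>r. card {x \<in> S (Suc r). Q (Suc r) x} / card (S (Suc r)))"
  defines "M \<equiv> \<Pi>\<^sub>M r\<in>{1..}. uniform_count_measure (S r)"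
  defines "C \<equiv> {\<omega> \<in> space M. finite {r \<in> {1..}. Q r (\<omega> r)}}"
  shows sets_finitely_often: "C \<in> sets M"
    and emeasure_finitely_often: "emeasure M C = 1"
proof -
  have prob: "prob_space (uniform_count_measure (S r))" if "r \<in> {1..}" for r
    using fin[OF that] ne[OF that] by (rule prob_space_uniform_count_measure)
  interpret M: prob_space M
    unfolding M_def using prob by (rule prob_space_PiM)
  define bad where "bad r = {\<omega> \<in> space M. Q (Suc r) (\<omega> (Suc r))}" for r
  have proj: "(\<lambda>\<omega>. \<omega> (Suc r)) \<in> M \<rightarrow>\<^sub>M uniform_count_measure (S (Suc r))" for r
    unfolding M_def by (rule measurable_component_singleton) simp
  have Qset: "{x \<in> S (Suc r). Q (Suc r) x} \<in> sets (uniform_count_measure (S (Suc r)))" for r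
    by (auto simp: sets_uniform_count_measure)
  have bad_eq: "bad r = (\<lambda>\<omega>. \<omega> (Suc r)) -` {x \<in> S (Suc r). Q (Suc r) x} \<inter> space M" for r
    using measurable_space[OF proj] by (auto simp: bad_def space_uniform_count_measure)
  have bad_sets[measurable]: "bad r \<in> sets M" for r
    unfolding bad_eq using proj Qset by (rule measurable_sets)
  have bad_measure: "measure M (bad r) = card {x \<in> S (Suc r). Q (Suc r) x} / card (S (Suc r))" for r
  proof -
    have "measure M (bad r)
        = measure (distr M (uniform_count_measure (S (Suc r))) (\<lambda>\<omega>. \<omega> (Suc r))) {x \<in> S (Suc r). Q (Suc r) x}"
      unfolding bad_eq using proj Qset by (rule measure_distr[symmetric])
    also have "distr M (uniform_count_measure (S (Suc r))) (\<lambda>\<omega>. \<omega> (Suc r)) = uniform_count_measure (S (Suc r))"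
      unfolding M_def using prob by (rule distr_PiM_component) auto
    finally show ?thesis
      using fin[of "Suc r"] by (simp add: measure_uniform_count_measure)
  qed
  have C_iff: "\<omega> \<in> C \<longleftrightarrow> \<omega> \<in> space M \<and> (\<forall>\<^sub>F r in sequentially. \<omega> \<in> space M - bad r)" for \<omega>
  proof -
    have "{r \<in> {1..}. Q r (\<omega> r)} = Suc ` {r. Q (Suc r) (\<omega> (Suc r))}"
      by (auto simp: image_iff) (metis Suc_le_D)
    then have "finite {r \<in> {1..}. Q r (\<omega> r)} \<longleftrightarrow> finite {r. Q (Suc r) (\<omega> (Suc r))}"
      by (simp add: finite_image_iff)
    then show ?thesis
      by (auto simp: C_def bad_def eventually_cofinite simp flip: cofinite_eq_sequentially)
  qed
  have "C = {\<omega> \<in> space M. \<exists>m. \<forall>r\<ge>m. \<omega> \<notin> bad r}"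
    by (subst set_eq_iff) (simp add: C_iff eventually_sequentially, blast)
  also have "\<dots> \<in> sets M" by measurable
  finally show C_sets: "C \<in> sets M" .
  have "AE \<omega> in M. \<forall>\<^sub>F r in sequentially. \<omega> \<in> space M - bad r"
    using summable by (intro borel_cantelli_AE1) (auto simp: bad_measure M.emeasure_eq_measure)
  then have "AE \<omega> in M. \<omega> \<in> C"
    using AE_space by eventually_elim (simp add: C_iff)
  then show "emeasure M C = 1"
    using M.emeasure_eq_1_AE[OF C_sets] by simp
qed

theorem theorem4p8:
  fixes k :: nat and n g :: "nat \<Rightarrow> nat" and \<gamma> :: "nat \<Rightarrow> real"
    and C :: "(nat \<Rightarrow> (nat \<Rightarrow> complex mat) \<Rightarrow> (nat \<Rightarrow> complex mat)) set"
  assumes "k \<ge> 2"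
    and "\<And>i. i \<in> {1..k} \<Longrightarrow> 1 \<le> n i"
    and "\<And>i j. 1 \<le> i \<Longrightarrow> i \<le> j \<Longrightarrow> j \<le> k \<Longrightarrow> n i \<le> n j"
    and "g 1 = 1"
    and "\<And>r. r \<ge> 1 \<Longrightarrow> g r < g (Suc r)"
    and "\<And>r. r \<ge> 1 \<Longrightarrow> g r dvd g (Suc r)"
    and "\<And>r. r \<ge> 1 \<Longrightarrow> \<gamma> r = real (g (Suc r)) / real (g r)"
    and "summable (\<lambda>r. \<gamma> (Suc r) powi (- int k))"
  defines "C \<equiv> {\<phi> \<in> space (ensemble k n g).
      finite {r \<in> {1..}. \<not> inj_on (\<phi> r) (chain_algebra k n g r)}}"
  shows "C \<in> sets (ensemble k n g) \<and> emeasure (ensemble k n g) C = 1"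
proof -
  have g_pos: "g r > 0" if "r \<ge> 1" for r
    using that assms(4) assms(5) by (induction r rule: dec_induct) (auto intro: order.strict_trans1)
  define d where "d r = g (Suc r) div g r" for r
  have g_Suc: "g (Suc r) = g r * d r" if "r \<ge> 1" for r
    using assms(6)[OF that] by (simp add: d_def)
  have d_pos: "d r > 0" if "r \<ge> 1" for r
    using g_Suc[OF that] g_pos[of "Suc r"] by (simp add: gr0_conv_Suc) (metis mult_0_right not_gr0 Suc_pred)
  have \<gamma>: "\<gamma> r = d r" if "r \<ge> 1" for r
    using g_pos[OF that] assms(7)[OF that] by (simp add: g_Suc[OF that])
  define S where "S = standard_homs k n g"
  \<comment> \<open>By monotonicity \<open>n k\<close> bounds all weights.\<close>
  define K where "K = k * (k * n k) ^ (2 * k)"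
  have S_eq: "S r = {\<phi>. standard_hom k (\<lambda>i. g r * n i) k (\<lambda>j. g r * (d r * n j)) \<phi>}" if "r \<ge> 1" for r
    by (simp add: S_def standard_homs_def g_Suc[OF that] mult.assoc)
  have fin: "finite (S r)" and ne: "S r \<noteq> {}" if "r \<in> {1..}" for r
  proof -
    have r: "r \<ge> 1" using that by simp
    have "1 \<le> g r * n i" if "i \<in> {1..k}" for i
      using g_pos[OF r] assms(2)[OF that] by (simp add: Suc_le_eq)
    then show "finite (S r)" unfolding S_eq[OF r] by (rule finite_standard_homs)
    show "S r \<noteq> {}"
      unfolding S_eq[OF r] using d_pos[OF r] g_pos[OF r] by (rule standard_homs_nonempty)
  qed
  have bound: "card {\<phi> \<in> S r. \<not> inj_on \<phi> (chain_algebra k n g r)} / card (S r) \<le> K * \<gamma> r powi (- int k)"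
    if r: "r \<ge> 1" for r
  proof -
    have "card {\<phi> \<in> S r. \<not> inj_on \<phi> (chain_algebra k n g r)} * d r ^ k \<le> K * card (S r)"
      unfolding S_eq[OF r] chain_algebra_def K_def
      using assms(2,3) by (intro card_non_injective_standard_homs g_pos r) auto
    then have "real (card {\<phi> \<in> S r. \<not> inj_on \<phi> (chain_algebra k n g r)}) * real (d r) ^ k \<le> K * card (S r)"
      unfolding of_nat_power[symmetric] of_nat_mult[symmetric] of_nat_le_iff .
    moreover have "card (S r) > 0" using fin[of r] ne[of r] r by (simp add: card_gt_0_iff)
    ultimately show ?thesis
      using d_pos[OF r] by (simp add: \<gamma>[OF r] power_int_minus field_simps)
  qed
  have summ: "summable (\<lambda>r. card {\<phi> \<in> S (Suc r). \<not> inj_on \<phi> (chain_algebra k n g (Suc r))} / card (S (Suc r)))"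
  proof (rule summable_comparison_test'[OF summable_mult[OF assms(8)]])
    fix r
    show "norm (card {\<phi> \<in> S (Suc r). \<not> inj_on \<phi> (chain_algebra k n g (Suc r))} / card (S (Suc r)))
        \<le> K * \<gamma> (Suc r) powi (- int k)"
      using bound[of "Suc r"] by (simp only: real_norm_def abs_of_nonneg divide_nonneg_nonneg of_nat_0_le_iff)
  qed
  show ?thesis
    unfolding C_def ensemble_def S_def[symmetric]
    using sets_finitely_often[where Q = "\<lambda>r \<phi>. \<not> inj_on \<phi> (chain_algebra k n g r)", OF fin ne summ]
      emeasure_finitely_often[where Q = "\<lambda>r \<phi>. \<not> inj_on \<phi> (chain_algebra k n g r)", OF fin ne summ]
    by (rule conjI)
qed

end
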